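(* Let $N\ge 5$ be an integer. The supremum $\sup_{E\in\mathcal{T}^N_3}P^N_s(E)$ is realised by the trunk graph whose associated sequence is $$\left(1,1,\left\lfloor \tfrac N3\right\rfloor-1\right)\ \text{ if } N\equiv 0 \pmod 3,\qquad \left(1,3,\left\lfloor \tfrac N3\right\rfloor-2\right)\ \text{ if } N\equiv 1\pmod 3,\qquad \left(1,2,\left\lfloor \tfrac N3\right\rfloor-1\right)\ \text{ if } N\equiv 2\pmod 3.$$
   Context: A trunk graph with $N$ edges is a directed graph with vertices $v_1,\dots,v_n$ ($n\ge2$) such that every edge goes from some $v_i$ to $v_{i+1}$, there are $m_i\ge1$ edges from $v_i$ to $v_{i+1}$ for each $1\le i\le n-1$, and $m_1+\dots+m_{n-1}=N$. It is written $(m_1,\dots,m_{n-1})$. $\mathcal{T}^N_3$ is the set of trunk graphs with $N$ edges and all $m_i\le 3$. A trunk graph has associated sequence $(n_1,n_2,n_3)$ (with $n_1,n_2,n_3\ge0$) if $(m_1,\dots,m_{n-1})$ consists of $n_1$ ones, followed by $n_2$ twos, followed by $n_3$ threes. $P^N_s(E)$ is the number of finite directed paths in $E$ (including the path of length $0$) ending at the unique sink $v_n$. *)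

theory Defs
  imports
    "Graph_Theory.Arc_Walk"
    "HOL-Library.Extended_Nat"
    "HOL-Library.Infinite_Typeclass"
begin

text \<open>
  Trunk graphs are treated as actual directed multigraphs. The predicate below says that \<open>G\<close> is a
  trunk graph written \<open>(m\<^sub>1, \<dots>, m\<^sub>n\<^sub>-\<^sub>1)\<close>, where \<open>n = length ms + 1\<close>. Indices are shifted by one:
  the vertex \<open>v\<^sub>i\<close> is \<open>v (i - 1)\<close> and \<open>m\<^sub>i\<close> is \<open>ms ! (i - 1)\<close>. Each multiplicity is at least 1, so
  every set of parallel arcs, and hence the whole graph, is finite.
\<close>

definition trunk_graph :: "('a, 'b) pre_digraph \<Rightarrow> nat list \<Rightarrow> bool" where
  "trunk_graph G ms \<longleftrightarrow>
     ms \<noteq> [] \<and> (\<forall>m\<in>set ms. m \<ge> 1) \<and>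
     (\<exists>v. bij_betw v {..length ms} (verts G) \<and>
        (\<forall>e\<in>arcs G. \<exists>i<length ms. tail G e = v i \<and> head G e = v (Suc i)) \<and>
        (\<forall>i<length ms. card {e \<in> arcs G. tail G e = v i \<and> head G e = v (Suc i)} = ms ! i))"

definition trunk_graphs_le3 :: "nat \<Rightarrow> ('a, 'b) pre_digraph set" where
  "trunk_graphs_le3 N =
     {G. \<exists>ms. trunk_graph G ms \<and> sum_list ms = N \<and> (\<forall>m\<in>set ms. m \<le> 3)}"

definition has_associated_sequence :: "('a, 'b) pre_digraph \<Rightarrow> nat \<times> nat \<times> nat \<Rightarrow> bool" where
  "has_associated_sequence G = (\<lambda>(n1, n2, n3).
     trunk_graph G (replicate n1 1 @ replicate n2 2 @ replicate n3 3))"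

definition is_sink :: "('a, 'b) pre_digraph \<Rightarrow> 'a \<Rightarrow> bool" where
  "is_sink G w \<longleftrightarrow> w \<in> verts G \<and> out_arcs G w = {}"

text \<open>
  A path is given by its start vertex and its list of arcs, so that a path of length 0 remembers
  its vertex. The library's \<open>awalk\<close> allows repeated vertices, as do directed paths here.
\<close>

definition paths_to_sink :: "('a, 'b) pre_digraph \<Rightarrow> ('a \<times> 'b list) set" where
  "paths_to_sink G = {(u, p). \<exists>w. is_sink G w \<and> pre_digraph.awalk G u p w}"

text \<open>
  The number of paths is an extended natural number, so that neither an infinite set of paths nor
  an unbounded supremum could silently receive the value 0.
\<close>

definition num_sink_paths :: "('a, 'b) pre_digraph \<Rightarrow> enat" where
  "num_sink_paths G =
     (if finite (paths_to_sink G) then enat (card (paths_to_sink G)) else \<infinity>)"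

end

theory Submission
  imports Defs
begin

text \<open>
  Paths to the sink correspond to choices of parallel arcs along a suffix of \<open>(m\<^sub>1, \<dots>, m\<^sub>n\<^sub>-\<^sub>1)\<close>, so
  their number \<open>P\<close> is the sum of all suffix products. Splitting off the last multiplicity \<open>m\<close>
  (next to the sink) gives \<open>P = 1 + m * P'\<close>, where \<open>P'\<close> belongs to the remaining trunk graph.
  Hence the maximum \<open>M N\<close> satisfies \<open>M N = Max {1 + m * M (N - m) | m. 1 \<le> m \<le> 3}\<close> for
  \<open>N \<ge> 3\<close>, and for \<open>N \<ge> 8\<close> the choice \<open>m = 3\<close> always wins.
\<close>

definition suffix_prod_sum :: "nat list \<Rightarrow> nat" where
  "suffix_prod_sum ms = (\<Sum>i\<le>length ms. prod_list (drop i ms))"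

lemma suffix_prod_sum_Nil [simp]: "suffix_prod_sum [] = 1"
  by (simp add: suffix_prod_sum_def)

lemma suffix_prod_sum_snoc [simp]:
  "suffix_prod_sum (ms @ [m]) = 1 + m * suffix_prod_sum ms"
  by (simp add: suffix_prod_sum_def sum_distrib_left mult.commute)

text \<open>The table runs up to 7 because a last multiplicity 2 still strictly beats 3 at 5 and 7:
  \<open>11 > 10\<close> and \<open>23 > 22\<close>.\<close>

function max_paths :: "nat \<Rightarrow> nat" where
  "N < 8 \<Longrightarrow> max_paths N = [1, 2, 3, 5, 7, 11, 16, 23] ! N"
| "max_paths (N + 8) = 1 + 3 * max_paths (N + 5)"
proof -
  fix P and x :: nat
  assume a: "\<And>N. N < 8 \<Longrightarrow> x = N \<Longrightarrow> P" and b: "\<And>N. x = N + 8 \<Longrightarrow> P"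
  show P
    using a[of x] b[of "x - 8"] by (cases "x < 8") auto
qed auto
termination by (relation "Wellfounded.measure id") auto

lemma max_paths_rec: "N \<ge> 8 \<Longrightarrow> max_paths N = 1 + 3 * max_paths (N - 3)"
  using max_paths.simps(2)[of "N - 8"] by simp

text \<open>After adding 1, this chain compares the last multiplicities 1, 2 and 3 for the total
  \<open>N + 3\<close>. The map \<open>x \<mapsto> 1 + 3 * x\<close> preserves both inequalities and
  shifts \<open>N\<close> by 3, so three consecutive base cases suffice.\<close>

lemma max_paths_ratios:
  assumes "N \<ge> 5"
  shows "max_paths (N + 2) \<le> 2 * max_paths (N + 1) \<and> 2 * max_paths (N + 1) \<le> 3 * max_paths N"
  using assms
proof (induction N rule: less_induct)
  case (less N)
  consider "N = 5" | "N = 6" | "N = 7" | "N \<ge> 8"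
    using less.prems by linarith
  then show ?case
  proof cases
    case 4
    then have K: "N = (N - 3) + 3" "N - 3 \<ge> 5"
      by simp_all
    then obtain K where K: "N = K + 3" "K \<ge> 5"
      by blast
    have "max_paths (N + i) = 1 + 3 * max_paths (K + i)" for i
      using max_paths_rec[of "N + i"] K by (simp add: add.commute)
    from this[of 0] this[of 1] this[of 2] less.IH[of K] K show ?thesis
      by simp
  qed (simp_all add: max_paths_rec nth_Cons')
qed

lemma max_paths_step:
  assumes "m \<in> {1, 2, 3}"
  shows "1 + m * max_paths N \<le> max_paths (N + m)"
proof (cases "N + m \<ge> 8")
  case True
  \<comment> \<open>Indexing by \<open>K\<close> fixes the total at \<open>K + 3\<close>, so that
    the three values of \<open>m\<close> become the three terms of the chain.\<close>
  define K where "K = N + m - 3"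
  have K: "K \<ge> 5" "max_paths (N + m) = 1 + 3 * max_paths K"
    using True max_paths_rec by (auto simp: K_def)
  have "N = K + 2 \<and> m = 1 \<or> N = K + 1 \<and> m = 2 \<or> N = K \<and> m = 3"
    using assms True by (auto simp: K_def)
  then show ?thesis
    using max_paths_ratios[OF K(1)] K(2) by auto
next
  case False
  then have "N < 8 - m" by simp
  then have "N \<in> {0, 1, 2, 3, 4, 5, 6}" using assms by auto
  with assms False show ?thesis
    by (auto simp: nth_Cons')
qed

text \<open>Induction runs from the sink end, where appending \<open>m\<close> acts by the monotone
  map \<open>x \<mapsto> 1 + m * x\<close>.\<close>

lemma suffix_prod_sum_le_max_paths:
  assumes "\<And>m. m \<in> set ms \<Longrightarrow> 1 \<le> m \<and> m \<le> 3"
  shows "suffix_prod_sum ms \<le> max_paths (sum_list ms)"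
  using assms
proof (induction ms rule: rev_induct)
  case Nil
  then show ?case by simp
next
  case (snoc m ms)
  have "suffix_prod_sum (ms @ [m]) \<le> 1 + m * max_paths (sum_list ms)"
    using snoc by simp
  also have "\<dots> \<le> max_paths (sum_list ms + m)"
    using snoc.prems[of m] by (intro max_paths_step) auto
  finally show ?case by simp
qed

definition optimal_list :: "nat \<Rightarrow> nat list" where
  "optimal_list N =
     (let (a, b, c) = (if N mod 3 = 0 then (1, 1, N div 3 - 1)
                       else if N mod 3 = 1 then (1, 3, N div 3 - 2)
                       else (1, 2, N div 3 - 1))
      in replicate a 1 @ replicate b 2 @ replicate c 3)"

text \<open>Adding 3 keeps the residue and raises the quotient by one, so only the block of threes
  grows.\<close>

lemma optimal_list_snoc:
  assumes "N \<ge> 5"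
  shows "optimal_list (N + 3) = optimal_list N @ [3]"
proof -
  \<comment> \<open>These bounds keep the subtractions in the number of threes from truncating at
    0.\<close>
  have "N div 3 \<ge> 1" "N mod 3 = 1 \<Longrightarrow> N div 3 \<ge> 2"
    using assms by presburger+
  then obtain k where "N div 3 = Suc k" "N mod 3 = 1 \<Longrightarrow> k \<ge> 1"
    by (cases "N div 3") auto
  then show ?thesis
    by (cases k) (auto simp: optimal_list_def replicate_append_same)
qed

lemma optimal_list_base:
  "optimal_list 5 = [1, 2, 2]" "optimal_list 6 = [1, 2, 3]" "optimal_list 7 = [1, 2, 2, 2]"
  by code_simp+

lemma optimal_list:
  assumes "N \<ge> 5"
  shows "sum_list (optimal_list N) = N \<and> suffix_prod_sum (optimal_list N) = max_paths N"
  using assms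
proof (induction N rule: less_induct)
  case (less N)
  consider "N = 5" | "N = 6" | "N = 7" | "N \<ge> 8"
    using less.prems by linarith
  then show ?case
  proof cases
    case 4
    then show ?thesis
      using less.IH[of "N - 3"] optimal_list_snoc[of "N - 3"] max_paths_rec[of N] by simp
  qed (simp_all add: optimal_list_base suffix_prod_sum_def atMost_nat_numeral atMost_Suc)
qed

text \<open>A walk from \<open>v i\<close> to the sink chooses one of the parallel arcs at each
  remaining level, which gives the product of a suffix.\<close>

lemma trunk_graph_num_sink_paths:
  assumes "trunk_graph G ms"
  shows "num_sink_paths G = enat (suffix_prod_sum ms)"
proof -
  define n where "n = length ms"
  obtain v where bij: "bij_betw v {..n} (verts G)"
    and arcs: "\<And>e. e \<in> arcs G \<Longrightarrow> \<exists>i<n. tail G e = v i \<and> head G e = v (Suc i)"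
    and card: "\<And>i. i < n \<Longrightarrow> card {e \<in> arcs G. tail G e = v i \<and> head G e = v (Suc i)} = ms ! i"
    and pos: "\<And>m. m \<in> set ms \<Longrightarrow> m \<ge> 1"
    using assms unfolding trunk_graph_def n_def by blast
  have inj: "inj_on v {..n}" and verts: "verts G = v ` {..n}"
    using bij by (auto simp: bij_betw_def)
  have v_eq: "v i = v j \<longleftrightarrow> i = j" if "i \<le> n" "j \<le> n" for i j
    using inj_on_eq_iff[OF inj] that by auto
  interpret wf_digraph G
  proof
    fix e assume "e \<in> arcs G"
    then obtain i where "i < n" "tail G e = v i" "head G e = v (Suc i)"
      using arcs by blast
    then show "tail G e \<in> verts G" "head G e \<in> verts G"
      by (auto simp: verts)
  qed
  define A where "A i = {e \<in> arcs G. tail G e = v i \<and> head G e = v (Suc i)}" for i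
  have A: "finite (A i)" "card (A i) = ms ! i" "A i \<noteq> {}" if "i < n" for i
  proof -
    show "card (A i) = ms ! i"
      using card[OF that] by (simp add: A_def)
    then have "card (A i) > 0"
      using pos[of "ms ! i"] that by (simp add: n_def)
    then show "finite (A i)" "A i \<noteq> {}"
      by (auto intro: card_ge_0_finite)
  qed
  \<comment> \<open>The tail alone determines the level of an arc. The case \<open>i = n\<close> is
    included on purpose: it says that no arc leaves \<open>v n\<close>.\<close>
  have tail_A: "e \<in> arcs G \<and> tail G e = v i \<longleftrightarrow> i < n \<and> e \<in> A i" if "i \<le> n" for e i
  proof
    assume e: "e \<in> arcs G \<and> tail G e = v i"
    then obtain j where "j < n" "tail G e = v j" "head G e = v (Suc j)"
      using arcs by blast
    then show "i < n \<and> e \<in> A i"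
      using e v_eq[of i j] that by (simp add: A_def)
  qed (simp add: A_def)
  have sink: "is_sink G w \<longleftrightarrow> w = v n" for w
  proof -
    have "out_arcs G (v i) = {} \<longleftrightarrow> i = n" if "i \<le> n" for i
      using tail_A[OF that] A(3)[of i] that unfolding out_arcs_def by fastforce
    then show ?thesis
      unfolding is_sink_def verts by auto
  qed
  define W where "W i = {p. awalk (v i) p (v n)}" for i
  have W_sink: "W n = {[]}"
  proof -
    have "\<not> awalk (v n) (e # p) (v n)" for e p
      using tail_A[of n e] by (auto simp: awalk_Cons_iff)
    then have "awalk (v n) p (v n) \<longleftrightarrow> p = []" for p
      using verts by (cases p) (auto simp: awalk_Nil_iff)
    then show ?thesis by (simp add: W_def)
  qed
  have W_step: "W i = (\<lambda>(e, p). e # p) ` (A i \<times> W (Suc i))" if "i < n" for i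
  proof -
    have "p \<in> W i \<longleftrightarrow> p \<in> (\<lambda>(e, p). e # p) ` (A i \<times> W (Suc i))" for p
    proof (cases p)
      case Nil
      then show ?thesis
        using that v_eq by (auto simp: W_def awalk_Nil_iff)
    next
      case (Cons e q)
      have "e # q \<in> W i \<longleftrightarrow> (e \<in> arcs G \<and> tail G e = v i) \<and> awalk (head G e) q (v n)"
        by (auto simp: W_def awalk_Cons_iff)
      also have "\<dots> \<longleftrightarrow> e \<in> A i \<and> q \<in> W (Suc i)"
        unfolding tail_A[OF less_imp_le[OF that]] using that by (auto simp: A_def W_def)
      finally show ?thesis
        by (auto simp: Cons)
    qed
    then show ?thesis by blast
  qed
  \<comment> \<open>Downward induction from the sink \<open>i = n\<close>, where the empty product
    counts the path of length 0.\<close>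
  have W: "finite (W i) \<and> card (W i) = prod_list (drop i ms)" if "i \<le> n" for i
    using that
  proof (induction rule: inc_induct)
    case base
    show ?case using W_sink by (simp add: n_def)
  next
    case (step i)
    have "inj_on (\<lambda>(e, p). e # p) (A i \<times> W (Suc i))"
      by (auto simp: inj_on_def)
    moreover have "drop i ms = ms ! i # drop (Suc i) ms"
      using step.hyps by (simp add: Cons_nth_drop_Suc n_def)
    ultimately show ?case
      using step A by (simp add: W_step card_image card_cartesian_product)
  qed
  \<comment> \<open>Each path is stored with its start vertex, so this union is disjoint by
    injectivity of \<open>v\<close>.\<close>
  have "paths_to_sink G = (\<Union>i\<le>n. {v i} \<times> W i)"
    unfolding paths_to_sink_def sink W_def using verts by (auto dest: awalk_hd_in_verts)
  moreover have "card (\<Union>i\<le>n. {v i} \<times> W i) = (\<Sum>i\<le>n. card ({v i} \<times> W i))"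
    using W v_eq by (intro card_UN_disjoint) auto
  ultimately show ?thesis
    using W by (simp add: num_sink_paths_def suffix_prod_sum_def n_def card_cartesian_product_singleton)
qed

text \<open>The infinite types have room for arbitrarily many vertices and arcs, so any admissible
  list can be realised.\<close>

lemma trunk_graph_exists:
  assumes "ms \<noteq> []" "\<And>m. m \<in> set ms \<Longrightarrow> m \<ge> 1"
  shows "\<exists>G :: ('a::infinite, 'b::infinite) pre_digraph. trunk_graph G ms"
proof -
  obtain a :: "nat \<Rightarrow> 'a" where a: "inj a"
    using infinite_countable_subset[OF infinite_UNIV] by blast
  obtain b :: "nat \<Rightarrow> 'b" where b: "inj b"
    using infinite_countable_subset[OF infinite_UNIV] by blast
  define arc where "arc = (\<lambda>i j. b (prod_encode (i, j)))"
  have arc_eq: "arc i j = arc i' j' \<longleftrightarrow> i = i' \<and> j = j'" for i j i' j'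
    by (simp add: arc_def inj_eq[OF b])
  \<comment> \<open>The level is read back from the name of an arc; values off the range of
    \<open>b\<close> are irrelevant, since only arcs of \<open>G\<close> matter.\<close>
  define idx where "idx e = fst (prod_decode (inv b e))" for e
  have idx: "idx (arc i j) = i" for i j
    by (simp add: idx_def arc_def b)
  define G :: "('a, 'b) pre_digraph" where
    "G = \<lparr>verts = a ` {..length ms}, arcs = {arc i j | i j. i < length ms \<and> j < ms ! i},
          tail = a \<circ> idx, head = a \<circ> Suc \<circ> idx\<rparr>"
  have "{e \<in> arcs G. tail G e = a i \<and> head G e = a (Suc i)} = arc i ` {..<ms ! i}"
    if "i < length ms" for i
    using that by (auto simp: G_def idx inj_eq[OF a])
  moreover have "inj_on (arc i) X" for i X
    by (auto simp: inj_on_def arc_eq)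
  ultimately have "card {e \<in> arcs G. tail G e = a i \<and> head G e = a (Suc i)} = ms ! i"
    if "i < length ms" for i
    using that by (simp add: card_image)
  moreover have "bij_betw a {..length ms} (verts G)"
    using a by (auto simp: bij_betw_def G_def intro: inj_on_subset)
  moreover have "\<forall>e\<in>arcs G. \<exists>i<length ms. tail G e = a i \<and> head G e = a (Suc i)"
    by (auto simp: G_def idx)
  ultimately show ?thesis
    unfolding trunk_graph_def using assms by blast
qed

theorem theorem4p11:
  fixes N :: nat and s :: "nat \<times> nat \<times> nat"
  assumes "N \<ge> 5"
    and "s = (if N mod 3 = 0 then (1, 1, N div 3 - 1)
              else if N mod 3 = 1 then (1, 3, N div 3 - 2)
              else (1, 2, N div 3 - 1))"
  shows "(\<exists>E :: ('a::infinite, 'b::infinite) pre_digraph. has_associated_sequence E s) \<and>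
         (\<forall>E :: ('a, 'b) pre_digraph. has_associated_sequence E s \<longrightarrow>
            E \<in> trunk_graphs_le3 N \<and>
            num_sink_paths E = (SUP E' \<in> (trunk_graphs_le3 N :: ('a, 'b) pre_digraph set). num_sink_paths E'))"
proof -
  have seq: "has_associated_sequence E s \<longleftrightarrow> trunk_graph E (optimal_list N)"
    for E :: "('a, 'b) pre_digraph"
    unfolding has_associated_sequence_def optimal_list_def assms(2) by simp
  have entries: "m \<in> set (optimal_list N) \<Longrightarrow> 1 \<le> m \<and> m \<le> 3" for m
    by (auto simp: optimal_list_def split: if_splits)
  have opt: "sum_list (optimal_list N) = N" "suffix_prod_sum (optimal_list N) = max_paths N"
    using optimal_list[OF assms(1)] by auto
  have "optimal_list N \<noteq> []"
    by (simp add: optimal_list_def)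
  then have "\<exists>E :: ('a, 'b) pre_digraph. has_associated_sequence E s"
    unfolding seq using entries by (intro trunk_graph_exists) auto
  moreover have "E \<in> trunk_graphs_le3 N \<and>
      num_sink_paths E = (SUP E' \<in> (trunk_graphs_le3 N :: ('a, 'b) pre_digraph set). num_sink_paths E')"
    if "has_associated_sequence E s" for E :: "('a, 'b) pre_digraph"
  proof
    have E: "trunk_graph E (optimal_list N)"
      using that seq by blast
    then show mem: "E \<in> trunk_graphs_le3 N"
      using entries opt by (auto simp: trunk_graphs_le3_def)
    have "num_sink_paths E' \<le> num_sink_paths E"
      if "E' \<in> trunk_graphs_le3 N" for E' :: "('a, 'b) pre_digraph"
    proof -
      obtain ms where ms: "trunk_graph E' ms" "sum_list ms = N" "\<forall>m\<in>set ms. m \<le> 3"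
        using \<open>E' \<in> trunk_graphs_le3 N\<close> by (auto simp: trunk_graphs_le3_def)
      then have "suffix_prod_sum ms \<le> max_paths N"
        using suffix_prod_sum_le_max_paths[of ms] by (auto simp: trunk_graph_def)
      then show ?thesis
        using trunk_graph_num_sink_paths[OF E] trunk_graph_num_sink_paths[OF ms(1)] opt by simp
    qed
    \<comment> \<open>The supremum is a maximum: \<open>E\<close> belongs to the family and its
      value bounds all others.\<close>
    then show "num_sink_paths E = (SUP E' \<in> (trunk_graphs_le3 N :: ('a, 'b) pre_digraph set). num_sink_paths E')"
      using mem by (intro antisym SUP_upper SUP_least)
  qed
  ultimately show ?thesis by blast
qed

end
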